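(* Let $\mathcal V=\{v\in\mathbb R^{nm}: Qv\succeq e,\ v\succeq0\}$ be nonempty, with $Q\in\mathbb R^{k\times nm}$, $e\in\mathbb R^k$. Then an optimal allocation $a^*$ for the robust utilitarian welfare problem $\max_{a\in\mathcal A}\min_{v\in\mathcal V}a^\top v$ can be computed by solving the linear program $$\max_{a\in\mathcal A,\ \beta\in\mathbb R_{\ge0}^{k}}\ \beta^\top e\quad\text{s.t.}\quad (Q^\top\beta)_G\preceq a_G\ \ \text{for all } G\in\mathcal G;$$ that is, the two problems have the same optimal value, and the $a$-component of any optimal solution of the linear program is optimal for the robust problem.
   Context: There are $n$ agents $N$, partitioned into groups $\mathcal G=\{G_1,\dots,G_g\}$, and $m$ item types $I$. Allocations and valuations are $n\times m$ matrices, vectorized in row-major order as $a,v\in\mathbb R^{nm}$; $x_G\in\mathbb R^{|G|m}$ is the restriction of a vector $x$ to the agents in $G$. $\succeq,\preceq$ are coordinatewise. The set of feasible (fractional) allocations $\mathcal A$ is assumed nonempty and consists of all $a\in\mathbb R_{\ge0}^{nm}$ with $\underline\kappa_j\le\sum_{i\in I}a_{j,i}\le\bar\kappa_j$ for each agent $j$, $\underline\psi_i\le\sum_{j\in N}a_{j,i}\le\bar\psi_i$ for each item $i$, and $a\preceq c$, for given real bounds. Group utilities are $u_G(a,v)=a_G^\top v_G/|G|$, and weighted utilitarian welfare is $\sum_G w_Gu_G$; weights are normalized to $w_G=|G|$, so welfare equals $a^\top v$. *)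

theory Defs
  imports "HOL-Analysis.Analysis"
begin

text \<open>
  Agents, item types and valuation constraints are indexed by finite types \<open>'n\<close>, \<open>'m\<close>, \<open>'k\<close>.
  A vectorized \<open>n \<times> m\<close> matrix is a vector over the index type \<open>'n \<times> 'm\<close>, with entry \<open>(j, i)\<close>
  for agent \<open>j\<close> and item \<open>i\<close>. The order on vectors is the coordinatewise one of the library.
\<close>

definition feasible_allocations ::
  "real^'n::finite \<Rightarrow> real^'n \<Rightarrow> real^'m::finite \<Rightarrow> real^'m \<Rightarrow> real^('n \<times> 'm)
    \<Rightarrow> (real^('n \<times> 'm)) set"
  where
  "feasible_allocations \<kappa>lo \<kappa>hi \<psi>lo \<psi>hi c =
    {a. 0 \<le> a
      \<and> (\<forall>j. \<kappa>lo $ j \<le> (\<Sum>i\<in>UNIV. a $ (j, i)) \<and> (\<Sum>i\<in>UNIV. a $ (j, i)) \<le> \<kappa>hi $ j)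
      \<and> (\<forall>i. \<psi>lo $ i \<le> (\<Sum>j\<in>UNIV. a $ (j, i)) \<and> (\<Sum>j\<in>UNIV. a $ (j, i)) \<le> \<psi>hi $ i)
      \<and> a \<le> c}"

definition group_utility :: "'n::finite set \<Rightarrow> real^('n \<times> 'm::finite) \<Rightarrow> real^('n \<times> 'm) \<Rightarrow> real"
  where
  "group_utility G a v = (\<Sum>p\<in>G \<times> UNIV. a $ p * v $ p) / real (card G)"

definition utilitarian_welfare ::
  "'n::finite set set \<Rightarrow> ('n set \<Rightarrow> real) \<Rightarrow> real^('n \<times> 'm::finite) \<Rightarrow> real^('n \<times> 'm) \<Rightarrow> real"
  where
  "utilitarian_welfare \<G> w a v = (\<Sum>G\<in>\<G>. w G * group_utility G a v)"

text \<open>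
  With weights equal to the group sizes, the welfare is the inner product of allocation and
  valuation; this is the form in which it enters the robust problem below.
\<close>

lemma utilitarian_welfare_card:
  fixes a v :: "real^('n::finite \<times> 'm::finite)"
  assumes "partition_on UNIV \<G>"
  shows "utilitarian_welfare \<G> (\<lambda>G. real (card G)) a v = a \<bullet> v"
proof -
  have "real (card G) * group_utility G a v = (\<Sum>j\<in>G. \<Sum>i\<in>UNIV. a $ (j, i) * v $ (j, i))"
    if "G \<in> \<G>" for G
  proof -
    have "G \<noteq> {}" using assms that by (auto simp: partition_on_def)
    then have "real (card G) \<noteq> 0" by simp
    then show ?thesis
      by (simp add: group_utility_def sum.cartesian_product split_def)
  qed
  then have "utilitarian_welfare \<G> (\<lambda>G. real (card G)) a v
      = (\<Sum>G\<in>\<G>. \<Sum>j\<in>G. \<Sum>i\<in>UNIV. a $ (j, i) * v $ (j, i))"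
    by (simp add: utilitarian_welfare_def)
  also have "\<dots> = (\<Sum>j\<in>\<Union>\<G>. \<Sum>i\<in>UNIV. a $ (j, i) * v $ (j, i))"
    using assms
    by (intro sum.Union_disjoint[symmetric, unfolded comp_def])
      (auto simp: partition_on_def disjoint_def)
  also have "\<dots> = (\<Sum>j\<in>UNIV. \<Sum>i\<in>UNIV. a $ (j, i) * v $ (j, i))"
    using assms by (simp add: partition_on_def)
  also have "\<dots> = a \<bullet> v"
    by (simp add: inner_vec_def sum.cartesian_product split_def)
  finally show ?thesis .
qed

definition polyhedral_valuations ::
  "real^('n::finite \<times> 'm::finite)^'k::finite \<Rightarrow> real^'k \<Rightarrow> (real^('n \<times> 'm)) set"
  where
  "polyhedral_valuations Q e = {v. e \<le> Q *v v \<and> 0 \<le> v}"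

text \<open>
  The infimum is used here only as a total rendering of the minimum over \<open>V\<close>; that it is
  attained is a separate claim.
\<close>

definition robust_welfare :: "(real^('n::finite \<times> 'm::finite)) set \<Rightarrow> real^('n \<times> 'm) \<Rightarrow> real"
  where
  "robust_welfare V a = (INF v\<in>V. a \<bullet> v)"

definition group_le :: "'n::finite set \<Rightarrow> real^('n \<times> 'm::finite) \<Rightarrow> real^('n \<times> 'm) \<Rightarrow> bool"
  where
  "group_le G x y \<longleftrightarrow> (\<forall>j\<in>G. \<forall>i. x $ (j, i) \<le> y $ (j, i))"

definition lp_feasible ::
  "(real^('n::finite \<times> 'm::finite)) set \<Rightarrow> 'n set set \<Rightarrow> real^('n \<times> 'm)^'k::finite
    \<Rightarrow> ((real^('n \<times> 'm)) \<times> (real^'k)) set"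
  where
  "lp_feasible A \<G> Q =
    {(a, \<beta>). a \<in> A \<and> 0 \<le> \<beta> \<and> (\<forall>G\<in>\<G>. group_le G (transpose Q *v \<beta>) a)}"

end

theory Submission
  imports Defs
begin

text \<open>For a fixed allocation \<open>a\<close>, minimizing \<open>a \<bullet> v\<close> over
  the polyhedron \<open>V\<close> is a linear program. Its dual maximizes
  \<open>\<beta> \<bullet> e\<close> over \<open>\<beta>\<close> with \<open>0 \<le> \<beta>\<close>
  and \<open>transpose Q *v \<beta> \<le> a\<close>. There is no gap
  (\<open>lp_weak_duality\<close>, \<open>lp_strong_duality\<close>), and some
  \<open>\<beta>\<close> attains the dual value, so the max-min becomes a joint maximum over
  \<open>a\<close> and \<open>\<beta>\<close>: maximizing out \<open>\<beta>\<close> leaves the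
  robust welfare of \<open>a\<close>. Strong duality and attainment of the inner minimum
  (\<open>lp_arg_min\<close>) both rest on the closedness of linear images of an orthant
  (\<open>closed_linear_image_orthant\<close>). The outer maximum is attained because the
  allocations form a compact set (\<open>compact_feasible_allocations\<close>,
  \<open>robust_welfare_arg_max\<close>).\<close>

section \<open>Closedness of finitely generated cones\<close>

lemma orthant_eq_convex_cone_hull:
  "{x. \<forall>b\<in>Basis. 0 \<le> x \<bullet> b} = convex_cone hull (Basis :: 'a::euclidean_space set)"
proof
  show "{x. \<forall>b\<in>Basis. 0 \<le> x \<bullet> b} \<subseteq> convex_cone hull (Basis :: 'a set)"
  proof
    fix x :: 'a
    assume x: "x \<in> {x. \<forall>b\<in>Basis. 0 \<le> x \<bullet> b}"
    \<comment> \<open>Passing to subsets of the basis permits induction; the full basis gives the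
      expansion of \<open>x\<close>.\<close>
    have "(\<Sum>b\<in>B. (x \<bullet> b) *\<^sub>R b) \<in> convex_cone hull Basis" if "B \<subseteq> Basis" for B
      using finite_subset[OF that finite_Basis] that x
      by (induction B rule: finite_induct)
        (auto intro!: convex_cone_hull_add convex_cone_hull_mul
          simp: convex_cone_hull_contains_0 hull_inc)
    from this[of Basis] show "x \<in> convex_cone hull Basis"
      by (simp add: euclidean_representation)
  qed
  show "convex_cone hull Basis \<subseteq> {x::'a. \<forall>b\<in>Basis. 0 \<le> x \<bullet> b}"
    by (rule hull_minimal)
      (auto simp: inner_Basis convex_cone_def convex_def conic_def inner_add_left intro: exI[of _ 0])
qed

text \<open>A linear image of a closed cone can fail to be closed, but this one is generated by the
  finitely many images of the basis vectors, and finitely generated cones are closed.\<close>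

lemma closed_linear_image_orthant:
  fixes h :: "'a::euclidean_space \<Rightarrow> 'b::euclidean_space"
  assumes "linear h"
  shows "closed (h ` {x. \<forall>b\<in>Basis. 0 \<le> x \<bullet> b})"
  unfolding orthant_eq_convex_cone_hull convex_cone_hull_linear_image[OF assms, symmetric]
  by (simp add: closed_convex_cone_hull)

lemma nonneg_vec_Basis:
  fixes x :: "real^'i"
  shows "0 \<le> x \<longleftrightarrow> (\<forall>b\<in>Basis. 0 \<le> x \<bullet> b)"
  by (auto simp: less_eq_vec_def Basis_vec_def inner_axis)

lemma inner_vec_nonneg:
  fixes x y :: "real^'i"
  assumes "0 \<le> x" "0 \<le> y"
  shows "0 \<le> x \<bullet> y"
  using assms by (auto simp: inner_vec_def less_eq_vec_def intro!: sum_nonneg)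

section \<open>Duality for a fixed allocation\<close>

text \<open>Pair each constraint's slack with the nonnegative variable dual to it, and add the two
  resulting inequalities; the terms in \<open>Q\<close> cancel by adjointness.\<close>

lemma lp_weak_duality:
  fixes Q :: "real^'p^'k"
  assumes "0 \<le> \<beta>" "transpose Q *v \<beta> \<le> a" "e \<le> Q *v v" "0 \<le> v"
  shows "\<beta> \<bullet> e \<le> a \<bullet> v"
proof -
  have "0 \<le> \<beta> \<bullet> (Q *v v - e)" "0 \<le> (a - transpose Q *v \<beta>) \<bullet> v"
    using assms by (auto intro!: inner_vec_nonneg simp: less_eq_vec_def)
  moreover have "\<beta> \<bullet> (Q *v v) = (transpose Q *v \<beta>) \<bullet> v"
    by (simp add: dot_lmul_matrix)
  ultimately show ?thesis
    by (simp add: inner_diff_left inner_diff_right)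
qed

text \<open>The set of attained values is a slice of the image of an orthant under a linear map.\<close>

lemma lp_arg_min:
  fixes Q :: "real^'p^'k"
  assumes "v0 \<in> {v. e \<le> Q *v v \<and> 0 \<le> v}" "\<And>v. e \<le> Q *v v \<Longrightarrow> 0 \<le> v \<Longrightarrow> b \<le> a \<bullet> v"
  shows "\<exists>v. is_arg_min (\<lambda>v. a \<bullet> v) (\<lambda>v. v \<in> {v. e \<le> Q *v v \<and> 0 \<le> v}) v"
proof -
  \<comment> \<open>Here \<open>s\<close> is the slack: \<open>Q *v v - s = e\<close> with
    \<open>0 \<le> s\<close> expresses feasibility of \<open>v\<close>, and the second component
    records its value.\<close>
  define h :: "(real^'p) \<times> (real^'k) \<Rightarrow> (real^'k) \<times> real"
    where "h = (\<lambda>(v, s). (Q *v v - s, a \<bullet> v))"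
  define T where "T = (\<lambda>v. a \<bullet> v) ` {v. e \<le> Q *v v \<and> 0 \<le> v}"
  have "linear h"
    by (auto simp: linear_iff h_def algebra_simps matrix_vector_mult_scaleR inner_add_right)
  then have "closed (h ` {x. \<forall>b\<in>Basis. 0 \<le> x \<bullet> b})"
    by (rule closed_linear_image_orthant)
  moreover have "{x. \<forall>b\<in>Basis. 0 \<le> x \<bullet> b} = {(v, s). 0 \<le> (v::real^'p) \<and> 0 \<le> (s::real^'k)}"
    by (auto simp: Basis_prod_def ball_Un nonneg_vec_Basis)
  ultimately have "closed ((\<lambda>t. (e, t)) -` h ` {(v, s). 0 \<le> v \<and> 0 \<le> s})"
    by (intro continuous_closed_vimage) (auto intro!: continuous_intros)
  also have "(\<lambda>t. (e, t)) -` h ` {(v, s). 0 \<le> v \<and> 0 \<le> s} = T"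
  proof -
    have "(e, t) \<in> h ` {(v, s). 0 \<le> v \<and> 0 \<le> s} \<longleftrightarrow> t \<in> T" for t
    proof
      assume "t \<in> T"
      then obtain v where "t = a \<bullet> v" "e \<le> Q *v v" "0 \<le> v"
        by (auto simp: T_def)
      then show "(e, t) \<in> h ` {(v, s). 0 \<le> v \<and> 0 \<le> s}"
        by (intro image_eqI[of _ _ "(v, Q *v v - e)"]) (auto simp: h_def less_eq_vec_def)
    qed (auto simp: h_def T_def less_eq_vec_def)
    then show ?thesis by auto
  qed
  finally have "closed T" .
  moreover have bdd: "bdd_below T"
    using assms(2) by (auto simp: T_def intro!: bdd_belowI2)
  moreover have "T \<noteq> {}"
    using assms(1) by (auto simp: T_def)
  ultimately have "Inf T \<in> T"
    by (intro closed_contains_Inf)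
  then obtain v where v: "e \<le> Q *v v" "0 \<le> v" "a \<bullet> v = Inf T"
    by (auto simp: T_def)
  have "a \<bullet> v \<le> a \<bullet> w" if "e \<le> Q *v w" "0 \<le> w" for w
    unfolding v(3) using that by (intro cInf_lower bdd) (auto simp: T_def)
  with v(1,2) show ?thesis
    by (auto simp: is_arg_min_linorder)
qed

text \<open>If \<open>(a, \<delta>)\<close> lies outside the closed cone of pairs \<open>(Q\<^sup>T \<beta> + s, \<beta> \<bullet> e - t)\<close>, a separating
  functional \<open>(y, \<eta>)\<close> has \<open>\<eta> \<le> 0\<close>: either \<open>y / - \<eta>\<close> is a feasible primal point of value below
  \<open>\<delta>\<close>, or \<open>\<eta> = 0\<close> and \<open>a \<bullet> y < 0\<close> with \<open>y \<ge> 0\<close>, which \<open>a \<ge> 0\<close> rules out.\<close>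

lemma lp_strong_duality:
  fixes Q :: "real^'p^'k"
  assumes "0 \<le> a" and lower: "\<And>v. e \<le> Q *v v \<Longrightarrow> 0 \<le> v \<Longrightarrow> \<delta> \<le> a \<bullet> v"
  obtains \<beta> where "0 \<le> \<beta>" "transpose Q *v \<beta> \<le> a" "\<delta> \<le> \<beta> \<bullet> e"
proof -
  define h :: "(real^'k) \<times> (real^'p) \<times> real \<Rightarrow> (real^'p) \<times> real"
    where "h = (\<lambda>(\<beta>, s, t). (transpose Q *v \<beta> + s, \<beta> \<bullet> e - t))"
  define P :: "((real^'k) \<times> (real^'p) \<times> real) set"
    where "P = {(\<beta>, s, t). 0 \<le> \<beta> \<and> 0 \<le> s \<and> 0 \<le> t}"
  have "linear h"
    by (auto simp: linear_iff h_def algebra_simps matrix_vector_mult_scaleR inner_add_left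
        simp del: transpose_matrix_vector)
  have P: "P = {x. \<forall>b\<in>Basis. 0 \<le> x \<bullet> b}"
    by (auto simp: P_def Basis_prod_def ball_Un nonneg_vec_Basis)
  have closed: "closed (h ` P)"
    unfolding P by (rule closed_linear_image_orthant) fact
  have convex: "convex (h ` P)"
    unfolding P orthant_eq_convex_cone_hull
    by (intro convex_linear_image \<open>linear h\<close> convex_convex_cone_hull)
  have "(a, \<delta>) \<in> h ` P"
  proof (rule ccontr)
    assume "(a, \<delta>) \<notin> h ` P"
    then obtain z b where sep: "z \<bullet> (a, \<delta>) < b" "\<And>x. x \<in> h ` P \<Longrightarrow> b < z \<bullet> x"
      using separating_hyperplane_closed_point[of "h ` P" "(a, \<delta>)"] closed convex
      by blast
    obtain y \<eta> where z: "z = (y, \<eta>)" by fastforce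
    \<comment> \<open>The cone contains the origin, which fixes the sign of
      \<open>b\<close>.\<close>
    have "b < z \<bullet> h (0, 0, 0)"
      by (intro sep(2) imageI) (simp add: P_def)
    then have "b < 0"
      by (simp add: h_def z)
    \<comment> \<open>A cone point with negative value could be rescaled by \<open>r\<close> until
      its value is exactly \<open>b\<close>, against strict separation.\<close>
    have cone: "0 \<le> z \<bullet> h x" if "x \<in> P" for x
    proof (rule ccontr)
      assume neg: "\<not> 0 \<le> z \<bullet> h x"
      define r where "r = b / (z \<bullet> h x)"
      have "0 \<le> r" using neg \<open>b < 0\<close> by (simp add: r_def divide_nonpos_nonpos)
      then have "r *\<^sub>R x \<in> P"
        using that by (auto simp: P_def less_eq_vec_def)
      then have "b < z \<bullet> h (r *\<^sub>R x)" using sep(2) by blast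
      also have "\<dots> = b"
        using neg by (simp add: r_def linear_scale[OF \<open>linear h\<close>])
      finally show False by simp
    qed
    \<comment> \<open>Testing \<open>cone\<close> on the generators in the directions
      \<open>s\<close>, \<open>t\<close> and \<open>\<beta>\<close> yields in turn the signs of
      \<open>y\<close> and \<open>\<eta>\<close> and the homogenized constraint on
      \<open>y\<close>.\<close>
    have y: "0 \<le> y"
    proof -
      have "0 \<le> y $ p" for p
      proof -
        have "(0, axis p 1, 0) \<in> P"
          by (simp add: P_def less_eq_vec_def axis_def)
        from cone[OF this] show ?thesis
          by (simp add: h_def z inner_axis)
      qed
      then show ?thesis by (simp add: less_eq_vec_def)
    qed
    have \<eta>: "\<eta> \<le> 0"
      using cone[of "(0, 0, 1)"] by (simp add: P_def h_def z)
    have Qy: "- \<eta> *\<^sub>R e \<le> Q *v y"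
    proof -
      have "- \<eta> * e $ i \<le> (Q *v y) $ i" for i
      proof -
        have "(axis i 1, 0, 0) \<in> P"
          by (simp add: P_def less_eq_vec_def axis_def)
        from cone[OF this] have "0 \<le> (transpose Q *v axis i 1) \<bullet> y + \<eta> * e $ i"
          by (simp add: h_def z inner_axis inner_commute)
        moreover have "(transpose Q *v axis i 1) \<bullet> y = (Q *v y) $ i"
          by (simp add: dot_lmul_matrix inner_axis')
        ultimately show ?thesis by simp
      qed
      then show ?thesis by (simp add: less_eq_vec_def)
    qed
    have less: "a \<bullet> y + \<eta> * \<delta> < 0"
      using sep(1) \<open>b < 0\<close> by (simp add: z inner_commute mult.commute)
    show False
    proof (cases "\<eta> = 0")
      case True
      then show False
        using less inner_vec_nonneg[OF \<open>0 \<le> a\<close> y] by simp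
    next
      case False
      with \<eta> have "\<eta> < 0" by simp
      \<comment> \<open>Scaling by \<open>r\<close> normalizes \<open>\<eta>\<close> to -1, so the
        homogenized constraint becomes the original one.\<close>
      define r where "r = - inverse \<eta>"
      have r: "0 < r" "r * \<eta> = -1"
        using \<open>\<eta> < 0\<close> by (simp_all add: r_def)
      have "e $ i \<le> (Q *v (r *\<^sub>R y)) $ i" for i
      proof -
        have "r * (- \<eta> * e $ i) \<le> r * (Q *v y) $ i"
          using Qy r(1) by (intro mult_left_mono) (auto simp: less_eq_vec_def)
        moreover have "r * (- \<eta> * e $ i) = - (r * \<eta>) * e $ i"
          by simp
        ultimately show ?thesis
          by (simp add: r(2) matrix_vector_mult_scaleR)
      qed
      then have "e \<le> Q *v (r *\<^sub>R y)"
        by (simp add: less_eq_vec_def)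
      moreover have "0 \<le> r *\<^sub>R y"
        using y r(1) by (simp add: less_eq_vec_def)
      ultimately have "\<delta> \<le> r * (a \<bullet> y)"
        using lower by fastforce
      moreover have "r * (a \<bullet> y) + (r * \<eta>) * \<delta> < 0"
        using mult_strict_left_mono[OF less r(1)] by (simp add: algebra_simps)
      ultimately show False
        by (simp add: r(2))
    qed
  qed
  then obtain \<beta> s t where
    "a = transpose Q *v \<beta> + s" "\<delta> = \<beta> \<bullet> e - t" "0 \<le> \<beta>" "0 \<le> s" "0 \<le> t"
    by (auto simp: h_def P_def)
  then show thesis
    by (intro that[of \<beta>]) (auto simp: less_eq_vec_def)
qed

section \<open>Attainment over allocations\<close>

lemma compact_feasible_allocations:
  "compact (feasible_allocations \<kappa>lo \<kappa>hi \<psi>lo \<psi>hi c)"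
proof -
  have "feasible_allocations \<kappa>lo \<kappa>hi \<psi>lo \<psi>hi c = cbox 0 c \<inter>
      {a. (\<forall>j. \<kappa>lo $ j \<le> (\<Sum>i\<in>UNIV. a $ (j, i)) \<and> (\<Sum>i\<in>UNIV. a $ (j, i)) \<le> \<kappa>hi $ j)
        \<and> (\<forall>i. \<psi>lo $ i \<le> (\<Sum>j\<in>UNIV. a $ (j, i)) \<and> (\<Sum>j\<in>UNIV. a $ (j, i)) \<le> \<psi>hi $ i)}"
    by (auto simp: feasible_allocations_def less_eq_vec_def interval_cbox_cart[symmetric])
  also have "compact \<dots>"
    by (intro compact_Int_closed compact_cbox closed_Collect_conj closed_Collect_all
        closed_Collect_le continuous_intros)
  finally show ?thesis .
qed

text \<open>The infimum of linear functionals is upper semicontinuous: its hypograph is closed.\<close>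

lemma robust_welfare_arg_max:
  assumes "compact A" "A \<noteq> {}" "V \<noteq> {}" and nonneg: "\<And>a v. a \<in> A \<Longrightarrow> v \<in> V \<Longrightarrow> 0 \<le> a \<bullet> v"
  shows "\<exists>a. is_arg_max (robust_welfare V) (\<lambda>a. a \<in> A) a"
proof -
  obtain v0 where v0: "v0 \<in> V" using assms(3) by auto
  have "compact ((\<lambda>a. a \<bullet> v0) ` A)"
    by (intro compact_continuous_image continuous_intros assms(1))
  then obtain B where B: "\<And>a. a \<in> A \<Longrightarrow> a \<bullet> v0 \<le> B"
    using assms(2) compact_attains_sup[of "(\<lambda>a. a \<bullet> v0) ` A"] by auto
  have bdd: "bdd_below ((\<lambda>v. a \<bullet> v) ` V)" if "a \<in> A" for a
    using nonneg[OF that] by (intro bdd_belowI2[of _ 0])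
  \<comment> \<open>The hypograph cut off at heights 0 and \<open>B\<close>, where \<open>B\<close>
    bounds the welfare at the single valuation \<open>v0\<close>. The cut makes it compact without
    losing any point of the graph.\<close>
  define H where "H = (A \<times> {0..B}) \<inter> {x. \<forall>v\<in>V. snd x \<le> fst x \<bullet> v}"
  have "compact H"
    unfolding H_def Ball_def
    by (intro compact_Int_closed compact_Times assms(1) compact_Icc closed_Collect_all
        closed_Collect_imp closed_Collect_le continuous_intros open_Collect_const)
  have mem_H: "(a, robust_welfare V a) \<in> H" if "a \<in> A" for a
  proof -
    have "0 \<le> robust_welfare V a"
      unfolding robust_welfare_def using assms(3) nonneg[OF that] by (rule cINF_greatest)
    moreover have le: "robust_welfare V a \<le> a \<bullet> v" if "v \<in> V" for v
      unfolding robust_welfare_def using bdd[OF \<open>a \<in> A\<close>] that by (rule cINF_lower)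
    moreover have "robust_welfare V a \<le> B"
      using le[OF v0] B[OF that] by simp
    ultimately show ?thesis
      using that by (auto simp: H_def)
  qed
  then have "H \<noteq> {}" using assms(2) by auto
  then obtain x where x: "x \<in> H" "\<And>y. y \<in> H \<Longrightarrow> snd y \<le> snd x"
    using continuous_attains_sup[OF \<open>compact H\<close> _ continuous_on_snd[OF continuous_on_id]]
    by blast
  have "snd x \<le> robust_welfare V (fst x)"
    unfolding robust_welfare_def using x(1) assms(3) by (intro cINF_greatest) (auto simp: H_def)
  moreover have "fst x \<in> A" using x(1) by (auto simp: H_def)
  ultimately have "is_arg_max (robust_welfare V) (\<lambda>a. a \<in> A) (fst x)"
    using x(2)[OF mem_H] by (force simp: is_arg_max_linorder)
  then show ?thesis ..
qed

section \<open>Equivalence of the two problems\<close>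

text \<open>The groups cover all agents, so the groupwise constraints together form one
  coordinatewise inequality.\<close>

lemma lp_feasible_eq:
  assumes "partition_on UNIV \<G>"
  shows "lp_feasible A \<G> Q = {(a, \<beta>). a \<in> A \<and> 0 \<le> \<beta> \<and> transpose Q *v \<beta> \<le> a}"
proof -
  have "(\<forall>G\<in>\<G>. group_le G x y) \<longleftrightarrow> x \<le> y" for x y :: "real^('a \<times> 'b)"
  proof -
    have "(\<forall>G\<in>\<G>. group_le G x y) \<longleftrightarrow> (\<forall>j\<in>\<Union>\<G>. \<forall>i. x $ (j, i) \<le> y $ (j, i))"
      by (auto simp: group_le_def)
    also have "\<Union>\<G> = UNIV"
      using assms by (simp add: partition_on_def)
    finally show ?thesis
      by (simp add: less_eq_vec_def)
  qed
  then show ?thesis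
    by (simp add: lp_feasible_def)
qed

lemma SUP_eq_is_arg_max:
  fixes f :: "'a \<Rightarrow> real"
  assumes "is_arg_max f (\<lambda>x. x \<in> S) x"
  shows "(SUP x\<in>S. f x) = f x"
  using assms by (intro cSup_eq_maximum) (auto simp: is_arg_max_linorder)

theorem corollary3p2:
  fixes \<G> :: "'n::finite set set"
    and \<kappa>lo \<kappa>hi :: "real^'n" and \<psi>lo \<psi>hi :: "real^'m::finite" and c :: "real^('n \<times> 'm)"
    and Q :: "real^('n \<times> 'm)^'k::finite" and e :: "real^'k"
    and A V :: "(real^('n \<times> 'm)) set"
  assumes "A = feasible_allocations \<kappa>lo \<kappa>hi \<psi>lo \<psi>hi c"
    and "V = polyhedral_valuations Q e"
    and "partition_on UNIV \<G>"
    and "A \<noteq> {}"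
    and "V \<noteq> {}"
  shows "(\<forall>a\<in>A. \<exists>v. is_arg_min (\<lambda>v. a \<bullet> v) (\<lambda>v. v \<in> V) v)
    \<and> (\<exists>a. is_arg_max (robust_welfare V) (\<lambda>a. a \<in> A) a)
    \<and> (\<exists>x. is_arg_max (\<lambda>(a, \<beta>). \<beta> \<bullet> e) (\<lambda>x. x \<in> lp_feasible A \<G> Q) x)
    \<and> (SUP a\<in>A. robust_welfare V a) = (SUP (a, \<beta>)\<in>lp_feasible A \<G> Q. \<beta> \<bullet> e)
    \<and> (\<forall>a \<beta>. is_arg_max (\<lambda>(a, \<beta>). \<beta> \<bullet> e) (\<lambda>x. x \<in> lp_feasible A \<G> Q) (a, \<beta>)
           \<longrightarrow> is_arg_max (robust_welfare V) (\<lambda>a. a \<in> A) a)"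
proof -
  have feas: "lp_feasible A \<G> Q = {(a, \<beta>). a \<in> A \<and> 0 \<le> \<beta> \<and> transpose Q *v \<beta> \<le> a}"
    using assms(3) by (rule lp_feasible_eq)
  have A_bounds: "0 \<le> a" "a \<le> c" if "a \<in> A" for a
    using that assms(1) by (auto simp: feasible_allocations_def)
  have V_iff: "v \<in> V \<longleftrightarrow> e \<le> Q *v v \<and> 0 \<le> v" for v
    using assms(2) by (simp add: polyhedral_valuations_def)
  have nonneg: "0 \<le> a \<bullet> v" if "a \<in> A" "v \<in> V" for a v
    using that A_bounds inner_vec_nonneg by (auto simp: V_iff)
  have arg_min: "\<exists>v. is_arg_min (\<lambda>v. a \<bullet> v) (\<lambda>v. v \<in> V) v" if "a \<in> A" for a
  proof -
    obtain v where "v \<in> V" using assms(5) by auto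
    then show ?thesis
      using lp_arg_min[of v e Q 0 a] nonneg[OF that] by (simp add: V_iff)
  qed
  have bdd: "bdd_below ((\<lambda>v. a \<bullet> v) ` V)" if "a \<in> A" for a
    using nonneg[OF that] by (intro bdd_belowI2[of _ 0])
  have weak: "\<beta> \<bullet> e \<le> robust_welfare V a" if "(a, \<beta>) \<in> lp_feasible A \<G> Q" for a \<beta>
    using that assms(5) unfolding robust_welfare_def
    by (intro cINF_greatest lp_weak_duality) (auto simp: feas V_iff)
  \<comment> \<open>Strong duality with \<open>\<delta>\<close> the infimum itself, which is a lower
    bound for all values \<open>a \<bullet> v\<close>.\<close>
  have strong: "\<exists>\<beta>. (a, \<beta>) \<in> lp_feasible A \<G> Q \<and> robust_welfare V a \<le> \<beta> \<bullet> e" if "a \<in> A" for a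
  proof (rule lp_strong_duality[OF A_bounds(1)[OF that]])
    show "robust_welfare V a \<le> a \<bullet> v" if "e \<le> Q *v v" "0 \<le> v" for v
      unfolding robust_welfare_def using that by (intro cINF_lower bdd \<open>a \<in> A\<close>) (simp add: V_iff)
  qed (use that in \<open>auto simp: feas\<close>)
  \<comment> \<open>By \<open>strong\<close>, the robust welfare of any competitor is at most some
    LP value, hence at most \<open>\<beta> \<bullet> e\<close>; by \<open>weak\<close>,
    \<open>a\<close> itself reaches \<open>\<beta> \<bullet> e\<close>.\<close>
  have lp_opt: "is_arg_max (robust_welfare V) (\<lambda>a. a \<in> A) a \<and> robust_welfare V a = \<beta> \<bullet> e"
    if opt: "is_arg_max (\<lambda>(a, \<beta>). \<beta> \<bullet> e) (\<lambda>x. x \<in> lp_feasible A \<G> Q) (a, \<beta>)" for a \<beta>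
  proof -
    have mem: "(a, \<beta>) \<in> lp_feasible A \<G> Q"
      using opt by (simp add: is_arg_max_linorder)
    then have "a \<in> A" by (simp add: feas)
    have "robust_welfare V a' \<le> \<beta> \<bullet> e" if "a' \<in> A" for a'
      using strong[OF that] opt by (force simp: is_arg_max_linorder)
    with weak[OF mem] \<open>a \<in> A\<close> show ?thesis
      by (force simp: is_arg_max_linorder intro: antisym)
  qed
  \<comment> \<open>The LP region may be unbounded in \<open>\<beta>\<close>, so its optimum is not
    obtained by compactness: a robust maximizer \<open>a\<close> is paired with an optimal
    multiplier.\<close>
  obtain a where a: "is_arg_max (robust_welfare V) (\<lambda>a. a \<in> A) a"
    using robust_welfare_arg_max[OF _ assms(4,5) nonneg] compact_feasible_allocations assms(1)
    by blast
  then obtain \<beta> where \<beta>: "(a, \<beta>) \<in> lp_feasible A \<G> Q" "robust_welfare V a \<le> \<beta> \<bullet> e"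
    using strong by (auto simp: is_arg_max_linorder)
  have opt: "is_arg_max (\<lambda>(a, \<beta>). \<beta> \<bullet> e) (\<lambda>x. x \<in> lp_feasible A \<G> Q) (a, \<beta>)"
  proof -
    have "\<beta>' \<bullet> e \<le> \<beta> \<bullet> e" if "(a', \<beta>') \<in> lp_feasible A \<G> Q" for a' \<beta>'
    proof -
      have "\<beta>' \<bullet> e \<le> robust_welfare V a'" using that by (rule weak)
      also have "\<dots> \<le> robust_welfare V a"
        using a that by (auto simp: is_arg_max_linorder feas)
      finally show ?thesis using \<beta>(2) by simp
    qed
    then show ?thesis
      using \<beta>(1) by (auto simp: is_arg_max_linorder)
  qed
  have "(SUP a\<in>A. robust_welfare V a) = (SUP (a, \<beta>)\<in>lp_feasible A \<G> Q. \<beta> \<bullet> e)"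
    using SUP_eq_is_arg_max[OF opt] SUP_eq_is_arg_max[OF a] lp_opt[OF opt] by simp
  then show ?thesis
    using arg_min lp_opt a opt by blast
qed

end
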